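(* Let $k$ be a positive integer. Suppose $G$ is a (simple, undirected) graph on $n$ vertices with girth at least $2k+1$ that contains $h$ Hamilton cycles. Then $M_k(S_n)\ge h/2^{n-1}$.
   Context: For a group $\Gamma$, $A\subseteq\Gamma$ is an $S_k$-set if whenever $\alpha_1\cdots\alpha_k=\beta_1\cdots\beta_k$ with all $\alpha_i,\beta_i\in A$, we have $(\alpha_1,\ldots,\alpha_k)=(\beta_1,\ldots,\beta_k)$. $M_k(\Gamma)$ denotes the maximum size of an $S_k$-set in $\Gamma$. $S_n$ is the symmetric group on $n$ letters. *)

theory Defs
  imports
    Complex_Main
    "HOL-Library.Extended_Nat"
    "HOL-Algebra.Sym_Groups"
begin

definition Sk_set :: "('a, 'b) monoid_scheme \<Rightarrow> nat \<Rightarrow> 'a set \<Rightarrow> bool" where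
  "Sk_set \<Gamma> k A \<longleftrightarrow> A \<subseteq> carrier \<Gamma> \<and>
     (\<forall>as bs. length as = k \<and> length bs = k \<and> set as \<subseteq> A \<and> set bs \<subseteq> A \<and>
        foldr (\<otimes>\<^bsub>\<Gamma>\<^esub>) as \<one>\<^bsub>\<Gamma>\<^esub> = foldr (\<otimes>\<^bsub>\<Gamma>\<^esub>) bs \<one>\<^bsub>\<Gamma>\<^esub> \<longrightarrow> as = bs)"

text \<open>Only meaningful when \<open>\<Gamma>\<close> has a finite carrier, as it is for the symmetric groups;
  the maximum is then attained, see \<open>max_Sk_size_attained\<close> below.\<close>

definition max_Sk_size :: "nat \<Rightarrow> ('a, 'b) monoid_scheme \<Rightarrow> nat" where
  "max_Sk_size k \<Gamma> = Max {card A |A. Sk_set \<Gamma> k A}"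

definition simple_graph :: "'v set \<Rightarrow> 'v set set \<Rightarrow> bool" where
  "simple_graph V E \<longleftrightarrow> finite V \<and> (\<forall>e\<in>E. e \<subseteq> V \<and> card e = 2)"

text \<open>A list \<open>vs\<close> of distinct vertices traverses a cycle with the wrap-around edge
  from \<open>last vs\<close> to \<open>hd vs\<close>; the first vertex is not repeated at the end, so the length
  of the list is the length of the cycle.\<close>

definition cycle_edges :: "'v list \<Rightarrow> 'v set set" where
  "cycle_edges vs = {{vs ! i, vs ! (Suc i mod length vs)} |i. i < length vs}"

definition is_cycle :: "'v set \<Rightarrow> 'v set set \<Rightarrow> 'v list \<Rightarrow> bool" where
  "is_cycle V E vs \<longleftrightarrow>
     3 \<le> length vs \<and> distinct vs \<and> set vs \<subseteq> V \<and> cycle_edges vs \<subseteq> E"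

text \<open>The girth of an acyclic graph is \<open>\<infinity>\<close>, the infimum of the empty set.\<close>

definition girth :: "'v set \<Rightarrow> 'v set set \<Rightarrow> enat" where
  "girth V E = Inf {enat (length vs) |vs. is_cycle V E vs}"

text \<open>Hamilton cycles are counted as subgraphs, hence identified with their edge sets:
  neither the starting vertex nor the direction of traversal matters.\<close>

definition hamilton_cycles :: "'v set \<Rightarrow> 'v set set \<Rightarrow> 'v set set set" where
  "hamilton_cycles V E = {cycle_edges vs |vs. is_cycle V E vs \<and> set vs = V}"

lemma finite_Sk_sizes:
  assumes "finite (carrier \<Gamma>)"
  shows "finite {card A |A. Sk_set \<Gamma> k A}"
proof -
  have "{card A |A. Sk_set \<Gamma> k A} \<subseteq> card ` Pow (carrier \<Gamma>)"
    by (auto simp: Sk_set_def)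
  then show ?thesis
    using assms by (meson finite_Pow_iff finite_imageI finite_subset)
qed

lemma Sk_set_empty: "Sk_set \<Gamma> k {}"
  by (auto simp: Sk_set_def)

lemma max_Sk_size_attained:
  assumes "finite (carrier \<Gamma>)"
  shows "\<exists>A. Sk_set \<Gamma> k A \<and> card A = max_Sk_size k \<Gamma>"
proof -
  have "Max {card A |A. Sk_set \<Gamma> k A} \<in> {card A |A. Sk_set \<Gamma> k A}"
    using finite_Sk_sizes[OF assms] Sk_set_empty by (intro Max_in) blast+
  then show ?thesis
    by (auto simp: max_Sk_size_def)
qed

lemma card_le_max_Sk_size:
  assumes "finite (carrier \<Gamma>)" "Sk_set \<Gamma> k A"
  shows "card A \<le> max_Sk_size k \<Gamma>"
  unfolding max_Sk_size_def using finite_Sk_sizes[OF assms(1)] assms(2)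
  by (intro Max_ge) auto

end

theory Submission
  imports Defs
begin

text \<open>Orient every edge of the graph at random. Each of the two traversals of a Hamilton cycle
  follows the orientation with probability \<open>2^-n\<close>, so some orientation has at least \<open>h / 2^(n-1)\<close>
  Hamilton cycles that are directed cycles; view each of these as a permutation of the vertices.
  If two products of \<open>k\<close> such permutations agree, then every vertex \<open>v\<close> is the origin of two directed
  walks of length \<open>k\<close> with a common end. A directed walk never backtracks, so if the two walks
  separated, traversing one backwards and then the other would give a non-backtracking closed walk,
  hence a cycle of length at most \<open>2k\<close>, against the girth assumption.\<close>

section \<open>Short cycles from non-backtracking walks\<close>

text \<open>Take a return to the same vertex after the smallest positive number \<open>d\<close> of
  steps. Minimality makes the vertices in between distinct; \<open>d = 1\<close> would be a loop and
  \<open>d = 2\<close> a backtrack, so the segment is a cycle.\<close>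

lemma closed_walk_contains_cycle:
  fixes w :: "nat \<Rightarrow> 'v"
  assumes G: "simple_graph V E"
    and m: "0 < m" "w 0 = w m"
    and edge: "\<And>i. i < m \<Longrightarrow> {w i, w (Suc i)} \<in> E"
    and nb: "\<And>i. i + 2 \<le> m \<Longrightarrow> w i \<noteq> w (i + 2)"
  shows "\<exists>vs. is_cycle V E vs \<and> length vs \<le> m"
proof -
  define P where "P = (\<lambda>d. 0 < d \<and> (\<exists>i. i + d \<le> m \<and> w i = w (i + d)))"
  define d where "d = (LEAST d. P d)"
  have "P m" using m by (auto simp: P_def)
  then have "P d" unfolding d_def by (rule LeastI)
  then obtain i where d: "0 < d" and i: "i + d \<le> m" "w i = w (i + d)"
    by (auto simp: P_def)
  have min: "d \<le> e" if "P e" for e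
    unfolding d_def using that by (rule Least_le)
  have "d \<noteq> 1"
  proof
    assume "d = 1"
    then have "{w i, w i} \<in> E" using edge[of i] i by simp
    then show False using G by (fastforce simp: simple_graph_def)
  qed
  moreover have "d \<noteq> 2" using nb[of i] i by auto
  ultimately have d3: "3 \<le> d" using d by linarith
  let ?vs = "map w [i..<i + d]"
  have inj: "a = b" if "a < d" "b < d" "a \<le> b" "w (i + a) = w (i + b)" for a b
  proof (rule ccontr)
    assume "a \<noteq> b"
    \<comment> \<open>A repetition inside the segment would be a shorter return.\<close>
    then have "P (b - a)"
      unfolding P_def using that i by (intro conjI exI[of _ "i + a"]) auto
    then show False using min[of "b - a"] that d by linarith
  qed
  have "inj_on w {i..<i + d}"
  proof (rule inj_onI)
    fix x y assume xy: "x \<in> {i..<i + d}" "y \<in> {i..<i + d}" "w x = w y"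
    show "x = y"
      using inj[of "x - i" "y - i"] inj[of "y - i" "x - i"] xy
      by (cases "x \<le> y") (auto simp: less_diff_conv2 diff_le_mono eq_diff_iff)
  qed
  then have dist: "distinct ?vs" by (simp add: distinct_map)
  have ce: "cycle_edges ?vs \<subseteq> E"
  proof
    fix e assume "e \<in> cycle_edges ?vs"
    then obtain j where j: "j < d" "e = {?vs ! j, ?vs ! (Suc j mod d)}"
      by (auto simp: cycle_edges_def)
    show "e \<in> E"
    proof (cases "Suc j < d")
      case True
      then show ?thesis using j edge[of "i + j"] i by simp
    next
      case False
      \<comment> \<open>The wrap-around edge is the last step of the segment, since
        \<open>w (i + d) = w i\<close>.\<close>
      then have "Suc j = d" using j by simp
      then show ?thesis using j edge[of "i + j"] i d by (auto simp flip: add_Suc_right)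
    qed
  qed
  have "set ?vs \<subseteq> V"
  proof
    fix x assume "x \<in> set ?vs"
    then obtain j where "j < i + d" "x = w j" by auto
    then show "x \<in> V" using edge[of j] G i by (auto simp: simple_graph_def)
  qed
  then have "is_cycle V E ?vs"
    unfolding is_cycle_def using d3 dist ce by simp
  then show ?thesis using i by (intro exI[of _ ?vs]) simp
qed

lemma directed_walks_same_start_end:
  fixes D :: "('v \<times> 'v) set" and u v :: "nat \<Rightarrow> 'v"
  assumes G: "simple_graph V E"
    and girth: "girth V E \<ge> enat (2 * k + 1)"
    and D: "\<And>x y. (x, y) \<in> D \<Longrightarrow> {x, y} \<in> E" "\<And>x y. (x, y) \<in> D \<Longrightarrow> (y, x) \<notin> D"
    and m: "0 < m" "m \<le> k"
    and u: "\<And>i. i < m \<Longrightarrow> (u i, u (Suc i)) \<in> D"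
    and v: "\<And>i. i < m \<Longrightarrow> (v i, v (Suc i)) \<in> D"
    and ends: "u 0 = v 0" "u m = v m"
  shows "u 1 = v 1"
proof (rule ccontr)
  assume ne: "u 1 \<noteq> v 1"
  \<comment> \<open>\<open>u\<close> backwards, then \<open>v\<close> forwards. The turn at the
    common origin lies in the interior, where \<open>u 1 \<noteq> v 1\<close> rules out a backtrack.
    The common end, where the walks may merge along the same edge, becomes the base point, at which
    \<open>closed_walk_contains_cycle\<close> imposes no condition.\<close>
  define w where "w = (\<lambda>i. if i \<le> m then u (m - i) else v (i - m))"
  have wu: "w i = u (m - i)" if "i \<le> m" for i using that by (simp add: w_def)
  have wv: "w i = v (i - m)" if "m \<le> i" for i
    using that ends by (cases "i = m") (auto simp: w_def)
  have "\<exists>vs. is_cycle V E vs \<and> length vs \<le> 2 * m"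
  proof (rule closed_walk_contains_cycle[OF G, where w = w])
    show "0 < 2 * m" using m by simp
    show "w 0 = w (2 * m)" using ends by (simp add: wu wv)
  next
    fix i assume i: "i < 2 * m"
    show "{w i, w (Suc i)} \<in> E"
    proof (cases "i < m")
      case True
      then show ?thesis
        using D(1)[OF u[of "m - Suc i"]] by (simp add: wu Suc_diff_Suc insert_commute)
    next
      case False
      then show ?thesis
        using D(1)[OF v[of "i - m"]] i by (simp add: wv Suc_diff_le)
    qed
  next
    fix i assume i: "i + 2 \<le> 2 * m"
    \<comment> \<open>Two consecutive steps lie inside \<open>u\<close>, around the turn, or inside
      \<open>v\<close>. Inside a walk, a backtrack would use an arc of \<open>D\<close> in both
      directions.\<close>
    consider "i + 2 \<le> m" | "Suc i = m" | "m \<le> i" by linarith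
    then show "w i \<noteq> w (i + 2)"
    proof cases
      case 1
      define j where "j = m - (i + 2)"
      have "m - i = Suc (Suc j)" "j < m" "Suc j < m" using 1 by (auto simp: j_def)
      then show ?thesis
        using 1 D(2)[OF u[of j]] u[of "Suc j"] wu[of i] wu[of "i + 2"] unfolding j_def[symmetric] by auto
    next
      case 2
      then show ?thesis using ne by (auto simp: wu wv)
    next
      case 3
      define j where "j = i - m"
      have "i + 2 - m = Suc (Suc j)" "j < m" "Suc j < m" using 3 i by (auto simp: j_def)
      then show ?thesis
        using 3 D(2)[OF v[of j]] v[of "Suc j"] wv[of i] wv[of "i + 2"] unfolding j_def[symmetric] by auto
    qed
  qed
  then obtain vs where vs: "is_cycle V E vs" "length vs \<le> 2 * m" by blast
  then have "girth V E \<le> enat (length vs)"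
    unfolding girth_def by (intro Inf_lower) auto
  then have "enat (2 * k + 1) \<le> enat (length vs)" using girth by (rule order_trans[rotated])
  then show False using vs m by simp
qed

section \<open>Permutations following an orientation\<close>

text \<open>An orientation selects from each edge its head.\<close>

definition orientations :: "'v set set \<Rightarrow> ('v set \<Rightarrow> 'v) set" where
  "orientations E = (\<Pi>\<^sub>E e\<in>E. e)"

text \<open>These are the covers of \<open>V\<close> by disjoint directed cycles, not only the
  directed Hamilton cycles; the S_k property holds for the whole set, and Hamilton cycles are
  recognised later by their edge sets.\<close>

definition oriented_perms :: "'v set \<Rightarrow> 'v set set \<Rightarrow> ('v set \<Rightarrow> 'v) \<Rightarrow> ('v \<Rightarrow> 'v) set" where
  "oriented_perms V E r = {p. p permutes V \<and> (\<forall>v\<in>V. {v, p v} \<in> E \<and> r {v, p v} = p v)}"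

definition perm_edges :: "'v set \<Rightarrow> ('v \<Rightarrow> 'v) \<Rightarrow> 'v set set" where
  "perm_edges V p = (\<lambda>v. {v, p v}) ` V"

lemma foldr_comp_permutes:
  "(\<And>p. p \<in> set ps \<Longrightarrow> p permutes V) \<Longrightarrow> foldr (\<circ>) ps id permutes V"
  by (induction ps) (auto intro: permutes_compose permutes_id)

lemma foldr_comp_append: "foldr (\<circ>) (ps @ qs) id = foldr (\<circ>) ps id \<circ> foldr (\<circ>) qs id"
  by (induction ps) (auto simp: o_assoc)

text \<open>The last factor of a product acts first, so \<open>u i\<close> is the image of
  \<open>v\<close> under the last \<open>i\<close> factors, and each further factor moves along one
  directed edge.\<close>

lemma oriented_walk_step:
  assumes ps: "set ps \<subseteq> oriented_perms V E r" and v: "v \<in> V" and i: "i < length ps"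
  defines "u \<equiv> \<lambda>i. foldr (\<circ>) (drop (length ps - i) ps) id v"
  shows "{u i, u (Suc i)} \<in> E \<and> r {u i, u (Suc i)} = u (Suc i) \<and> u i \<in> V"
proof -
  define j where "j = length ps - Suc i"
  have j: "length ps - i = Suc j" "j < length ps" using i by (auto simp: j_def)
  have "u (Suc i) = (ps ! j) (u i)"
    unfolding u_def j(1) j_def[symmetric] by (subst Cons_nth_drop_Suc[symmetric, OF j(2)]) simp
  moreover have "foldr (\<circ>) (drop (Suc j) ps) id permutes V"
    using ps by (intro foldr_comp_permutes) (auto simp: oriented_perms_def dest!: in_set_dropD)
  then have "u i \<in> V" unfolding u_def j(1) using v by (simp add: permutes_in_image)
  moreover have "ps ! j \<in> oriented_perms V E r" using ps j(2) by auto
  ultimately show ?thesis by (auto simp: oriented_perms_def)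
qed

text \<open>The last factors give the first steps of the two walks from each vertex, so
  \<open>directed_walks_same_start_end\<close> forces them to agree. They can then be cancelled;
  allowing every length up to \<open>k\<close> lets the induction continue with the shorter
  products.\<close>

lemma oriented_perms_products_inj:
  assumes G: "simple_graph V E"
    and girth: "girth V E \<ge> enat (2 * k + 1)"
  shows "length ps = length qs \<Longrightarrow> length ps \<le> k \<Longrightarrow>
    set ps \<subseteq> oriented_perms V E r \<Longrightarrow> set qs \<subseteq> oriented_perms V E r \<Longrightarrow>
    foldr (\<circ>) ps id = foldr (\<circ>) qs id \<Longrightarrow> ps = qs"
proof (induction ps arbitrary: qs rule: rev_induct)
  case Nil
  then show ?case by simp
next
  case (snoc p ps)
  then obtain q qs' where qs: "qs = qs' @ [q]"
    by (cases qs rule: rev_cases) auto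
  have pq: "p \<in> oriented_perms V E r" "q \<in> oriented_perms V E r"
    using snoc.prems qs by auto
  then have perm: "p permutes V" "q permutes V" by (auto simp: oriented_perms_def)
  define D where "D = {(x, y). {x, y} \<in> E \<and> r {x, y} = y}"
  have "p v = q v" if v: "v \<in> V" for v
  proof -
    define walk where "walk = (\<lambda>xs i. foldr (\<circ>) (drop (length xs - i) xs) id v)"
    have len: "length (ps @ [p]) = length qs" using snoc.prems by simp
    \<comment> \<open>Both walks start at \<open>v\<close> and end at the value of the common
      product at \<open>v\<close>; their first steps lead to \<open>p v\<close> and
      \<open>q v\<close>.\<close>
    have "walk (ps @ [p]) 1 = walk qs 1"
    proof (rule directed_walks_same_start_end[OF G girth, where D = D and m = "length qs"])
      show "{x, y} \<in> E" if "(x, y) \<in> D" for x y using that by (auto simp: D_def)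
      show "(y, x) \<notin> D" if "(x, y) \<in> D" for x y
        using that G by (fastforce simp: D_def simple_graph_def insert_commute)
      show "0 < length qs" using qs by simp
      show "length qs \<le> k" using snoc.prems by simp
      show "(walk (ps @ [p]) i, walk (ps @ [p]) (Suc i)) \<in> D" if "i < length qs" for i
        using oriented_walk_step[OF snoc.prems(3) v, of i] that
        unfolding walk_def D_def len by blast
      show "(walk qs i, walk qs (Suc i)) \<in> D" if "i < length qs" for i
        using oriented_walk_step[OF snoc.prems(4) v, of i] that
        unfolding walk_def D_def by simp
      show "walk (ps @ [p]) 0 = walk qs 0" by (simp add: walk_def)
      show "walk (ps @ [p]) (length qs) = walk qs (length qs)"
        using snoc.prems(5) len unfolding walk_def by (metis diff_self_eq_0 drop_0)
    qed
    then show ?thesis by (simp add: walk_def qs)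
  qed
  then have "p = q" using perm by (metis permutes_not_in ext)
  have cancel: "foldr (\<circ>) ps id = foldr (\<circ>) qs' id"
  proof -
    have "foldr (\<circ>) ps id \<circ> p = foldr (\<circ>) qs' id \<circ> p"
      using snoc.prems(5) \<open>p = q\<close> unfolding qs foldr_comp_append by (simp add: comp_def)
    then have "foldr (\<circ>) ps id \<circ> (p \<circ> inv' p) = foldr (\<circ>) qs' id \<circ> (p \<circ> inv' p)"
      by (simp add: o_assoc)
    then show ?thesis using permutes_inv_o(1)[OF perm(1)] by simp
  qed
  have "ps = qs'"
    by (rule snoc.IH[OF _ _ _ _ cancel]) (use snoc.prems qs in auto)
  then show ?case using qs \<open>p = q\<close> by simp
qed

section \<open>Relabelling the vertices by the numbers from 1 to \<open>n\<close>\<close>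

lemma foldr_map_permutation:
  assumes "inj_on f V" "\<And>p. p \<in> set ps \<Longrightarrow> p permutes V"
  shows "foldr (\<circ>) (map (map_permutation V f) ps) id = map_permutation V f (foldr (\<circ>) ps id)"
  using assms(2)
proof (induction ps)
  case Nil
  then show ?case using map_permutation_ident'[OF assms(1)] by simp
next
  case (Cons p ps)
  then have "foldr (\<circ>) ps id permutes V" by (intro foldr_comp_permutes) auto
  then have "map_permutation V f (p \<circ> foldr (\<circ>) ps id) =
      map_permutation V f p \<circ> map_permutation V f (foldr (\<circ>) ps id)"
    by (rule map_permutation_compose'[OF assms(1)])
  moreover have "foldr (\<circ>) (map (map_permutation V f) ps) id = map_permutation V f (foldr (\<circ>) ps id)"
    using Cons by (metis list.set_intros(2))
  ultimately show ?case by (metis comp_apply foldr_Cons list.simps(9))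
qed

lemma inj_on_map_permutation:
  assumes "inj_on f V"
  shows "inj_on (map_permutation V f) {p. p permutes V}"
proof (rule inj_on_inverseI)
  fix p assume "p \<in> {p. p permutes V}"
  then show "map_permutation (f ` V) (inv_into V f) (map_permutation V f p) = p"
    using assms by (intro map_permutation_compose_inv) (auto simp: bij_betw_def)
qed

text \<open>Relabelling along a bijection \<open>f\<close> is injective and respects products, so it
  carries the S_k property from permutations of \<open>V\<close> into \<open>sym_group n\<close>
  without changing the cardinality.\<close>

lemma card_oriented_perms_le:
  assumes G: "simple_graph V E" and n: "card V = n"
    and girth: "girth V E \<ge> enat (2 * k + 1)"
  shows "card (oriented_perms V E r) \<le> max_Sk_size k (sym_group n)"
proof -
  let ?P = "oriented_perms V E r"
  have "finite V" using G by (simp add: simple_graph_def)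
  then obtain f where f: "bij_betw f V {1..n}"
    using finite_same_card_bij[of V "{1..n}"] n by auto
  then have inj: "inj_on f V" by (simp add: bij_betw_def)
  let ?F = "map_permutation V f"
  have P: "?P \<subseteq> {p. p permutes V}" by (auto simp: oriented_perms_def)
  have "Sk_set (sym_group n) k (?F ` ?P)"
    unfolding Sk_set_def
  proof (intro conjI allI impI)
    show "?F ` ?P \<subseteq> carrier (sym_group n)"
      using P map_permutation_permutes[OF f] by (auto simp: sym_group_def)
  next
    fix as bs
    assume *: "length as = k \<and> length bs = k \<and> set as \<subseteq> ?F ` ?P \<and> set bs \<subseteq> ?F ` ?P \<and>
      foldr (\<otimes>\<^bsub>sym_group n\<^esub>) as \<one>\<^bsub>sym_group n\<^esub> = foldr (\<otimes>\<^bsub>sym_group n\<^esub>) bs \<one>\<^bsub>sym_group n\<^esub>"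
    have "as \<in> lists (?F ` ?P)" "bs \<in> lists (?F ` ?P)" using * by auto
    then obtain ps qs where ps: "as = map ?F ps" "set ps \<subseteq> ?P" and qs: "bs = map ?F qs" "set qs \<subseteq> ?P"
      unfolding lists_image by auto
    have perm: "foldr (\<circ>) xs id permutes V" "foldr (\<circ>) (map ?F xs) id = ?F (foldr (\<circ>) xs id)"
      if "set xs \<subseteq> ?P" for xs
      using that P by (auto intro!: foldr_comp_permutes foldr_map_permutation[OF inj])
    have "?F (foldr (\<circ>) ps id) = ?F (foldr (\<circ>) qs id)"
      using * perm(2)[OF ps(2)] perm(2)[OF qs(2)] by (simp add: ps qs sym_group_def)
    then have "foldr (\<circ>) ps id = foldr (\<circ>) qs id"
      using inj_onD[OF inj_on_map_permutation[OF inj]] perm(1)[OF ps(2)] perm(1)[OF qs(2)] by simp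
    then have "ps = qs"
      using * ps qs by (intro oriented_perms_products_inj[OF G girth]) auto
    then show "as = bs" by (simp add: ps qs)
  qed
  moreover have "card (?F ` ?P) = card ?P"
    using inj_on_subset[OF inj_on_map_permutation[OF inj] P] by (rule card_image)
  moreover have "finite (carrier (sym_group n))"
    by (simp add: sym_group_def finite_permutations)
  ultimately show ?thesis using card_le_max_Sk_size by metis
qed

section \<open>Averaging over orientations\<close>

lemma finite_edges: "simple_graph V E \<Longrightarrow> finite E"
  unfolding simple_graph_def by (meson PowI finite_Pow_iff finite_subset subsetI)

lemma card_orientations:
  assumes "simple_graph V E"
  shows "card (orientations E) = 2 ^ card E"
  using assms finite_edges[OF assms]
  by (simp add: orientations_def card_PiE simple_graph_def)

lemma finite_orientations:
  assumes "simple_graph V E"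
  shows "finite (orientations E)"
  using card_orientations[OF assms] by (intro card_ge_0_finite) simp

text \<open>Two distinct vertices with the same edge would be swapped by \<open>p\<close>.\<close>

lemma inj_on_perm_edge:
  assumes "\<And>v. v \<in> V \<Longrightarrow> p (p v) \<noteq> v"
  shows "inj_on (\<lambda>v. {v, p v}) V"
  using assms by (intro inj_onI) (metis doubleton_eq_iff)

text \<open>Following \<open>p\<close> prescribes the heads of \<open>card V\<close> distinct edges
  and leaves two choices for every other edge. The product form avoids a subtraction in the
  exponent.\<close>

lemma card_orientations_of_perm:
  assumes G: "simple_graph V E" and p: "p permutes V"
    and edges: "perm_edges V p \<subseteq> E"
    and pp: "\<And>v. v \<in> V \<Longrightarrow> p (p v) \<noteq> v"
  shows "card {r \<in> orientations E. p \<in> oriented_perms V E r} * 2 ^ card V = 2 ^ card E"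
proof -
  note inj = inj_on_perm_edge[of V p, OF pp]
  have fin: "finite E" by (rule finite_edges[OF G])
  let ?C = "perm_edges V p"
  \<comment> \<open>The head that \<open>p\<close> prescribes for an edge; the tail is recovered
    from the edge by injectivity.\<close>
  define H where "H = (\<lambda>e. p (inv_into V (\<lambda>v. {v, p v}) e))"
  have H: "H {v, p v} = p v" if "v \<in> V" for v
    unfolding H_def using inv_into_f_f[OF inj that] by simp
  have "{r \<in> orientations E. p \<in> oriented_perms V E r} =
      (\<Pi>\<^sub>E e\<in>E. if e \<in> ?C then {H e} else e)" (is "?L = ?R")
  proof (intro equalityI subsetI)
    fix r assume "r \<in> ?L"
    then show "r \<in> ?R"
      by (auto simp: orientations_def oriented_perms_def perm_edges_def PiE_iff H)
  next
    fix r assume r: "r \<in> ?R"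
    have "r {v, p v} = p v" if "v \<in> V" for v
    proof -
      have "{v, p v} \<in> ?C" "{v, p v} \<in> E" using that edges by (auto simp: perm_edges_def)
      then show ?thesis using r H[OF that] by (auto simp: PiE_iff dest!: bspec)
    qed
    moreover have "r e \<in> e" if "e \<in> E" for e
    proof (cases "e \<in> ?C")
      case True
      then obtain v where "v \<in> V" "e = {v, p v}" by (auto simp: perm_edges_def)
      then show ?thesis using calculation by auto
    next
      case False
      then show ?thesis using r that by (auto simp: PiE_iff dest!: bspec)
    qed
    ultimately show "r \<in> ?L"
      using r p edges by (auto simp: orientations_def oriented_perms_def PiE_iff perm_edges_def)
  qed
  then have "card ?L = (\<Prod>e\<in>E. card (if e \<in> ?C then {H e} else e))"
    using fin by (simp add: card_PiE)
  also have "\<dots> = (\<Prod>e\<in>E. if e \<in> ?C then 1 else 2)"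
    using G by (intro prod.cong) (auto simp: simple_graph_def)
  also have "\<dots> = 2 ^ card (E - ?C)"
    using fin by (simp add: prod.If_cases Diff_eq Collect_neg_eq)
  finally have "card ?L = 2 ^ card (E - ?C)" .
  moreover have "card ?C = card V" unfolding perm_edges_def by (rule card_image[OF inj])
  ultimately show ?thesis
    using card_Diff_subset[of ?C E] card_mono[OF fin edges] finite_subset[OF edges fin] edges
    by (simp flip: power_add)
qed

text \<open>The permutation moves each vertex to its successor in the list. A cycle has length at
  least 3, so two steps never lead back.\<close>

lemma hamilton_cycle_permutation:
  assumes "C \<in> hamilton_cycles V E"
  obtains p where "p permutes V" "C = perm_edges V p" "\<And>v. v \<in> V \<Longrightarrow> p (p v) \<noteq> v"
    "C \<subseteq> E" "V \<noteq> {}"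
proof -
  obtain vs where C: "C = cycle_edges vs" and vs: "is_cycle V E vs" "set vs = V"
    using assms by (auto simp: hamilton_cycles_def)
  have len: "3 \<le> length vs" and dist: "distinct vs" using vs by (auto simp: is_cycle_def)
  let ?n = "length vs"
  define p where "p = cycle_of_list vs"
  \<comment> \<open>Applying the cyclic permutation to its own list shifts the list by one
    place.\<close>
  have "map p vs = rotate1 vs"
    using cyclic_rotation[OF dist, of 1] by (simp add: p_def)
  then have p: "p (vs ! i) = vs ! (Suc i mod ?n)" if "i < ?n" for i
    using nth_rotate1[OF that] that by (metis nth_map)
  have "perm_edges V p = {{vs ! i, p (vs ! i)} |i. i < ?n}"
    unfolding perm_edges_def vs(2)[symmetric] set_conv_nth by auto
  also have "\<dots> = C" unfolding C cycle_edges_def using p by force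
  finally have "C = perm_edges V p" ..
  moreover have "p (p v) \<noteq> v" if v: "v \<in> V" for v
  proof -
    obtain i where i: "i < ?n" "v = vs ! i" using v vs(2) in_set_conv_nth[of v vs] by auto
    have lt: "Suc i mod ?n < ?n" "Suc (Suc i mod ?n) mod ?n < ?n"
      using i(1) by (intro mod_less_divisor; linarith)+
    have "Suc (Suc i mod ?n) mod ?n \<noteq> i"
      using len i(1) by (auto simp: mod_Suc)
    then show ?thesis
      using p[OF i(1)] p[OF lt(1)] i nth_eq_iff_index_eq[OF dist lt(2) i(1)] by simp
  qed
  moreover have "p permutes V" unfolding p_def using cycle_permutes[of vs] vs(2) by simp
  moreover have "C \<subseteq> E" using vs C by (simp add: is_cycle_def)
  moreover have "V \<noteq> {}" using vs len by auto
  ultimately show ?thesis using that by blast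
qed

text \<open>The factor \<open>2\<close> comes from the two traversals, given by a permutation and its inverse.\<close>

lemma card_orientations_of_hamilton_cycle:
  assumes G: "simple_graph V E" and C: "C \<in> hamilton_cycles V E"
  shows "2 * 2 ^ card E \<le>
    card {r \<in> orientations E. C \<in> perm_edges V ` oriented_perms V E r} * 2 ^ card V"
proof -
  obtain p where p: "p permutes V" and Cp: "C = perm_edges V p"
    and pp: "\<And>v. v \<in> V \<Longrightarrow> p (p v) \<noteq> v" and CE: "C \<subseteq> E" and ne: "V \<noteq> {}"
    using hamilton_cycle_permutation[OF C] by blast
  let ?q = "inv' p"
  have q: "?q permutes V" by (rule permutes_inv[OF p])
  have pq [simp]: "p (?q v) = v" "?q (p v) = v" for v
    using permutes_inverses[OF p] by auto
  \<comment> \<open>Writing the vertices as \<open>p v\<close> turns the edges of the inverse into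
    \<open>{p v, v}\<close>.\<close>
  have "perm_edges V ?q = (\<lambda>v. {v, ?q v}) ` p ` V"
    using permutes_image[OF p] by (simp add: perm_edges_def)
  also have "\<dots> = C" unfolding Cp perm_edges_def by (simp add: image_image insert_commute)
  finally have Cq: "perm_edges V ?q = C" .
  have qq: "?q (?q v) \<noteq> v" if "v \<in> V" for v
    using pp[OF that] by (metis pq(1))
  let ?S = "\<lambda>p. {r \<in> orientations E. p \<in> oriented_perms V E r}"
  \<comment> \<open>An orientation following both traversals would give the edge
    \<open>{v, p v}\<close> both \<open>v\<close> and \<open>p v\<close> as its head.\<close>
  have disj: "?S p \<inter> ?S ?q = {}"
  proof (rule ccontr)
    assume "?S p \<inter> ?S ?q \<noteq> {}"
    then obtain r where r: "p \<in> oriented_perms V E r" "?q \<in> oriented_perms V E r" by auto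
    obtain v where v: "v \<in> V" using ne by blast
    then have pv: "p v \<in> V" using p by (simp add: permutes_in_image)
    have "r {v, p v} = p v" "r {p v, ?q (p v)} = ?q (p v)" "{v, p v} \<in> E"
      using r v pv by (auto simp: oriented_perms_def)
    then have "p v = v" by (simp add: insert_commute)
    then show False using pp[OF v] by simp
  qed
  have fin: "finite (orientations E)" by (rule finite_orientations[OF G])
  have "card (?S p \<union> ?S ?q) = card (?S p) + card (?S ?q)"
    using fin disj by (intro card_Un_disjoint) auto
  moreover have "card (?S p \<union> ?S ?q) \<le>
      card {r \<in> orientations E. C \<in> perm_edges V ` oriented_perms V E r}"
    using fin Cp Cq by (intro card_mono) auto
  ultimately have "(card (?S p) + card (?S ?q)) * 2 ^ card V \<le>
      card {r \<in> orientations E. C \<in> perm_edges V ` oriented_perms V E r} * 2 ^ card V"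
    by (intro mult_right_mono) auto
  moreover have "card (?S p) * 2 ^ card V = 2 ^ card E"
    using CE Cp by (intro card_orientations_of_perm[OF G p _ pp]) auto
  moreover have "card (?S ?q) * 2 ^ card V = 2 ^ card E"
    using CE Cq by (intro card_orientations_of_perm[OF G q _ qq]) auto
  ultimately show ?thesis by (simp add: distrib_right)
qed

theorem theorem1p11:
  fixes V :: "'v set" and E :: "'v set set" and k n h :: nat
  assumes "k > 0"
    and "simple_graph V E"
    and "card V = n"
    and "girth V E \<ge> enat (2 * k + 1)"
    and "card (hamilton_cycles V E) = h"
  shows "real (max_Sk_size k (sym_group n)) \<ge> real h / 2 ^ (n - 1)"
proof (cases "hamilton_cycles V E = {}")
  case True
  then show ?thesis using assms(5) by simp
next
  case False
  note G = assms(2)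
  let ?H = "hamilton_cycles V E"
  let ?M = "max_Sk_size k (sym_group n)"
  let ?O = "orientations E"
  let ?Q = "\<lambda>r C. C \<in> perm_edges V ` oriented_perms V E r"
  have finV: "finite V" using G by (simp add: simple_graph_def)
  obtain C where "C \<in> ?H" using False by blast
  then have "V \<noteq> {}" by (elim hamilton_cycle_permutation)
  \<comment> \<open>A Hamilton cycle forces \<open>n > 0\<close>, so the truncated
    \<open>n - 1\<close> is the true difference.\<close>
  then have n: "n = Suc (n - 1)" using assms(3) finV by (metis Suc_pred' card_gt_0_iff)
  have "?H \<subseteq> Pow E" by (auto simp: hamilton_cycles_def is_cycle_def)
  then have finH: "finite ?H" using finite_edges[OF G] by (meson finite_Pow_iff finite_subset)
  note finO = finite_orientations[OF G]
  \<comment> \<open>Each cycle counted is the edge set of some permutation following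
    \<open>r\<close>, and those permutations number at most \<open>?M\<close>.\<close>
  have le: "card {C \<in> ?H. ?Q r C} \<le> ?M" for r
  proof -
    have fin: "finite (oriented_perms V E r)"
      by (rule finite_subset[OF _ finite_permutations[OF finV]]) (auto simp: oriented_perms_def)
    have "card {C \<in> ?H. ?Q r C} \<le> card (perm_edges V ` oriented_perms V E r)"
      using fin by (intro card_mono) auto
    also have "\<dots> \<le> card (oriented_perms V E r)" by (rule card_image_le[OF fin])
    also have "\<dots> \<le> ?M" by (rule card_oriented_perms_le[OF G assms(3,4)])
    finally show ?thesis .
  qed
  \<comment> \<open>Double count the pairs of a Hamilton cycle and an orientation that one of its
    traversals follows: from below by cycles, from above by orientations.\<close>
  have "h * (2 * 2 ^ card E) \<le> (\<Sum>C\<in>?H. card {r \<in> ?O. ?Q r C} * 2 ^ n)"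
    using sum_mono[of ?H "\<lambda>_. 2 * 2 ^ card E", OF card_orientations_of_hamilton_cycle[OF G]]
      assms(3,5) by simp
  also have "\<dots> = (\<Sum>C\<in>?H. card {r \<in> ?O. ?Q r C}) * 2 ^ n"
    by (simp add: sum_distrib_right)
  also have "(\<Sum>C\<in>?H. card {r \<in> ?O. ?Q r C}) = (\<Sum>r\<in>?O. card {C \<in> ?H. ?Q r C})"
    using sum_multicount_gen[OF finH finO, of "\<lambda>C r. ?Q r C" "\<lambda>r. card {C \<in> ?H. ?Q r C}"] by simp
  also have "\<dots> \<le> (\<Sum>r\<in>?O. ?M)" by (intro sum_mono le)
  also have "\<dots> = 2 ^ card E * ?M" by (simp add: card_orientations[OF G])
  finally have "h * (2 * 2 ^ card E) \<le> 2 ^ card E * ?M * 2 ^ Suc (n - 1)"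
    using n by (simp add: mult_right_mono)
  \<comment> \<open>Cancelling \<open>2 ^ card E\<close> and the factor 2 of the two traversals
    leaves the exponent \<open>n - 1\<close>.\<close>
  then have "h \<le> ?M * 2 ^ (n - 1)" by simp
  then have "real h \<le> real ?M * 2 ^ (n - 1)"
    by (metis of_nat_le_iff of_nat_mult of_nat_numeral of_nat_power)
  then show ?thesis by (simp add: divide_le_eq)
qed

end
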